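(* Let $e,n$ be positive integers. Then the poset $(NCP(e,e,n+1),\preccurlyeq)$ is a lattice.
   Context: $\mu_d\subset\mathbb{C}$ denotes the group of complex $d$-th roots of unity. A partition of a set $x$ is a set of disjoint non-empty subsets of $x$ (its parts) with union $x$. For partitions $u,v$ of the same set, $u\preccurlyeq v$ ($u$ refines $v$) means that every part of $u$ is contained in some part of $v$. For a finite subset $x\subset\mathbb{C}$, a partition of $x$ is non-crossing if any two of its parts whose convex hulls intersect are equal; $NCP_x$ is the set of non-crossing partitions of $x$. $NCP(e,1,n)$ is the set of elements of $NCP_{\mu_{en}}$ fixed by the action of $\mu_e$ by multiplication on $\mu_{en}$. For $u\in NCP_{\mu_{en}\cup\{0\}}$, $u^{\flat}\in NCP_{\mu_{en}}$ is the partition obtained by forgetting $0$ (restricting $u$ to $\mu_{en}$). $NCP(e,e,n+1):=\{u\in NCP_{\mu_{en}\cup\{0\}} \mid u^{\flat}\in NCP(e,1,n)\}$, ordered by $\preccurlyeq$. A lattice is a poset in which any two elements have a greatest lower bound and a least upper bound. *)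

theory Defs
  imports "HOL-Analysis.Analysis" "HOL-Algebra.Lattice"
begin

definition roots_of_unity :: "nat \<Rightarrow> complex set" where
  "roots_of_unity d = {z. z ^ d = 1}"

text \<open>
  Non-crossing partitions of \<open>x\<close>. The notion is meant for finite \<open>x\<close>, and it is only applied
  to finite sets below as long as \<open>e\<close> and \<open>n\<close> are positive.
\<close>

definition NCP :: "complex set \<Rightarrow> complex set set set" where
  "NCP x = {u. partition_on x u \<and>
     (\<forall>p\<in>u. \<forall>q\<in>u. convex hull p \<inter> convex hull q \<noteq> {} \<longrightarrow> p = q)}"

definition mult_partition :: "complex \<Rightarrow> complex set set \<Rightarrow> complex set set" where
  "mult_partition z u = (\<lambda>p. (*) z ` p) ` u"

definition NCP_e1 :: "nat \<Rightarrow> nat \<Rightarrow> complex set set set" where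
  "NCP_e1 e n =
     {u \<in> NCP (roots_of_unity (e * n)). \<forall>z\<in>roots_of_unity e. mult_partition z u = u}"

text \<open>
  The restriction of a partition to a subset \<open>y\<close>: a part disjoint from \<open>y\<close>, such as \<open>{0}\<close>
  when \<open>0\<close> is forgotten, disappears.
\<close>

definition restrict_partition :: "complex set \<Rightarrow> complex set set \<Rightarrow> complex set set" where
  "restrict_partition y u = (\<inter>) y ` u - {{}}"

text \<open>\<open>NCP_ee e n\<close> is the set written \<open>NCP(e,e,n+1)\<close>.\<close>

definition NCP_ee :: "nat \<Rightarrow> nat \<Rightarrow> complex set set set" where
  "NCP_ee e n =
     {u \<in> NCP (roots_of_unity (e * n) \<union> {0}).
        restrict_partition (roots_of_unity (e * n)) u \<in> NCP_e1 e n}"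

definition NCP_ee_poset :: "nat \<Rightarrow> nat \<Rightarrow> complex set set gorder" where
  "NCP_ee_poset e n =
     \<lparr>carrier = NCP_ee e n, eq = (=), le = refines (roots_of_unity (e * n) \<union> {0})\<rparr>"

end

theory Submission
  imports Defs "HOL-Algebra.Complete_Lattice"
begin

text \<open>
  The set \<open>NCP(e,e,n+1)\<close> contains the one-part partition and is closed under common refinement:
  the parts of a common refinement are contained in parts of the given partitions, so they are
  still non-crossing, and both restriction and multiplication by a root of unity commute with
  common refinement. Hence any nonempty family has an infimum, and a poset with a greatest
  element and infima of nonempty families is a complete lattice; joins are infima of upper bounds.
\<close>

text \<open>Every later argument handles a part through such a choice function \<open>f\<close> and
  transports \<open>f\<close> pointwise. An empty family would give the single part
  \<open>UNIV\<close>, which is why the families below are nonempty.\<close>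

lemma mem_common_refinement_iff:
  "X \<in> common_refinement \<P> \<longleftrightarrow>
     X \<noteq> {} \<and> (\<exists>f. (\<forall>P\<in>\<P>. f P \<in> P) \<and> X = (\<Inter>P\<in>\<P>. f P))"
  by (auto simp: common_refinement Pi_iff)

text \<open>A part of \<open>Q\<close> has a point, which lies in some part of \<open>P\<close>;
  that part also belongs to \<open>Q\<close>, so disjointness identifies the two. Equality of
  partitions thus follows from a single inclusion.\<close>

lemma partition_on_subset_eq:
  assumes "partition_on A P" "partition_on A Q" "P \<subseteq> Q"
  shows "P = Q"
proof (rule refines_asym)
  show "refines A P Q"
    using assms by (auto simp: refines_def)
  show "refines A Q P"
    unfolding refines_def
  proof (intro conjI ballI assms)
    fix q assume q: "q \<in> Q"
    then obtain x where x: "x \<in> q"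
      using assms(2) by (metis all_not_in_conv partition_onD3)
    with q have "x \<in> A"
      using partition_onD1[OF assms(2)] by blast
    then obtain p where "p \<in> P" "x \<in> p"
      using assms(1) by (auto simp: partition_on_def)
    moreover from this have "p = q"
      using assms(2,3) q x by (auto simp: partition_on_def disjoint_def)
    ultimately show "\<exists>p\<in>P. q \<subseteq> p"
      by auto
  qed
qed

lemma NCP_partition_on: "u \<in> NCP x \<Longrightarrow> partition_on x u"
  by (simp add: NCP_def)

lemma singleton_in_NCP: "x \<noteq> {} \<Longrightarrow> {x} \<in> NCP x"
  by (auto simp: NCP_def partition_on_def)

text \<open>Hulls are monotone: if the hulls of two parts meet, so do the hulls of the parts chosen
  for them in each \<open>P\<close>. Hence both choice functions agree on the family.\<close>

lemma common_refinement_in_NCP: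
  assumes "\<P> \<subseteq> NCP x" "\<P> \<noteq> {}"
  shows "common_refinement \<P> \<in> NCP x"
  unfolding NCP_def
proof (intro CollectI conjI ballI impI)
  show "partition_on x (common_refinement \<P>)"
    using assms by (intro partition_on_common_refinement) (auto simp: NCP_partition_on)
  fix p q
  assume "p \<in> common_refinement \<P>" "q \<in> common_refinement \<P>"
    and meet: "convex hull p \<inter> convex hull q \<noteq> {}"
  then obtain f g where f: "\<forall>P\<in>\<P>. f P \<in> P" "p = (\<Inter>P\<in>\<P>. f P)"
    and g: "\<forall>P\<in>\<P>. g P \<in> P" "q = (\<Inter>P\<in>\<P>. g P)"
    by (auto simp: mem_common_refinement_iff)
  have "f P = g P" if P: "P \<in> \<P>" for P
  proof -
    have "convex hull p \<subseteq> convex hull f P" "convex hull q \<subseteq> convex hull g P"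
      using f(2) g(2) P by (auto intro!: hull_mono)
    then have "convex hull f P \<inter> convex hull g P \<noteq> {}"
      using meet by blast
    with assms(1) P f(1) g(1) show ?thesis
      by (auto simp: NCP_def)
  qed
  then show "p = q"
    using f(2) g(2) by simp
qed

lemma partition_on_restrict_partition:
  assumes "partition_on x u" "y \<subseteq> x"
  shows "partition_on y (restrict_partition y u)"
  using partition_on_restrict[OF assms(1), of y] assms(2)
  by (simp add: restrict_partition_def Int_absorb2)

lemma restrict_common_refinement:
  assumes part: "\<And>u. u \<in> \<P> \<Longrightarrow> partition_on x u" and "\<P> \<noteq> {}" "y \<subseteq> x"
  shows "restrict_partition y (common_refinement \<P>)
    = common_refinement (restrict_partition y ` \<P>)"
proof (rule sym, rule partition_on_subset_eq)
  show "partition_on y (common_refinement (restrict_partition y ` \<P>))"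
    using assms by (intro partition_on_common_refinement)
      (auto intro: partition_on_restrict_partition)
  show "partition_on y (restrict_partition y (common_refinement \<P>))"
    using assms by (intro partition_on_restrict_partition partition_on_common_refinement)
  show "common_refinement (restrict_partition y ` \<P>)
      \<subseteq> restrict_partition y (common_refinement \<P>)"
  proof
    fix X assume "X \<in> common_refinement (restrict_partition y ` \<P>)"
    then obtain g where X: "X \<noteq> {}" "X = (\<Inter>P\<in>\<P>. g (restrict_partition y P))"
      and g: "\<forall>P\<in>\<P>. g (restrict_partition y P) \<in> restrict_partition y P"
      \<comment> \<open>Since \<open>g\<close> chooses parts of the restricted partitions, each
        choice is the trace on \<open>y\<close> of some part of \<open>P\<close>; lifting these
        traces gives \<open>f\<close>. Nonemptiness of the family then allows \<open>y\<close> to be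
        pulled out of the intersection.\<close>
      by (auto simp: mem_common_refinement_iff)
    from g have "\<forall>P\<in>\<P>. \<exists>p\<in>P. g (restrict_partition y P) = y \<inter> p"
      by (auto simp: restrict_partition_def)
    then obtain f where f: "\<forall>P\<in>\<P>. f P \<in> P \<and> g (restrict_partition y P) = y \<inter> f P"
      by metis
    with X(2) \<open>\<P> \<noteq> {}\<close> have "X = y \<inter> (\<Inter>P\<in>\<P>. f P)"
      by auto
    moreover from this X(1) f have "(\<Inter>P\<in>\<P>. f P) \<in> common_refinement \<P>"
      by (auto simp: mem_common_refinement_iff)
    ultimately show "X \<in> restrict_partition y (common_refinement \<P>)"
      using X(1) by (auto simp: restrict_partition_def)
  qed
qed

text \<open>Multiplication by \<open>z\<close> is injective, so it commutes with nonempty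
  intersections, and it permutes the parts of each invariant partition.\<close>

lemma mult_common_refinement:
  assumes inv: "\<And>u. u \<in> \<P> \<Longrightarrow> mult_partition z u = u" and "z \<noteq> 0" "\<P> \<noteq> {}"
  shows "mult_partition z (common_refinement \<P>) = common_refinement \<P>"
proof -
  have mult_Int: "(*) z ` (\<Inter>P\<in>\<P>. f P) = (\<Inter>P\<in>\<P>. (*) z ` f P)" for f :: "complex set set \<Rightarrow> complex set"
  proof -
    obtain P\<^sub>0 where "P\<^sub>0 \<in> \<P>"
      using assms(3) by blast
    then show ?thesis
      using assms(2) by (intro image_INT[of _ UNIV _ _ P\<^sub>0]) (auto simp: inj_on_def)
  qed
  show ?thesis
  proof (intro equalityI subsetI)
    fix X assume "X \<in> mult_partition z (common_refinement \<P>)"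
    then obtain Y where Y: "Y \<in> common_refinement \<P>" "X = (*) z ` Y"
      by (auto simp: mult_partition_def)
    then obtain f where f: "\<forall>P\<in>\<P>. f P \<in> P" "X = (*) z ` (\<Inter>P\<in>\<P>. f P)" and "X \<noteq> {}"
      by (auto simp: mem_common_refinement_iff)
    moreover have "\<forall>P\<in>\<P>. (*) z ` f P \<in> P"
      using f(1) inv unfolding mult_partition_def by blast
    ultimately show "X \<in> common_refinement \<P>"
      unfolding mem_common_refinement_iff mult_Int
      by (intro conjI exI[of _ "\<lambda>P. (*) z ` f P"]) auto
  next
    fix X assume "X \<in> common_refinement \<P>"
    then obtain f where f: "\<forall>P\<in>\<P>. f P \<in> P" "X = (\<Inter>P\<in>\<P>. f P)" and "X \<noteq> {}"
      by (auto simp: mem_common_refinement_iff)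
    \<comment> \<open>Invariance is read in the other direction here: every part is the image of a
      part, so the choice function can be pulled back along \<open>z\<close>.\<close>
    have "\<forall>P\<in>\<P>. \<exists>p\<in>P. f P = (*) z ` p"
      using f(1) inv unfolding mult_partition_def by blast
    then obtain h where h: "\<forall>P\<in>\<P>. h P \<in> P \<and> f P = (*) z ` h P"
      by metis
    then have X: "X = (*) z ` (\<Inter>P\<in>\<P>. h P)"
      by (simp add: mult_Int f(2))
    with h \<open>X \<noteq> {}\<close> have "(\<Inter>P\<in>\<P>. h P) \<in> common_refinement \<P>"
      unfolding mem_common_refinement_iff by blast
    with X show "X \<in> mult_partition z (common_refinement \<P>)"
      by (auto simp: mult_partition_def)
  qed
qed

lemma roots_of_unity_nonzero: "z \<in> roots_of_unity d \<Longrightarrow> d > 0 \<Longrightarrow> z \<noteq> 0"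
  by (auto simp: roots_of_unity_def power_0_left)

lemma mult_roots_of_unity:
  assumes "z \<in> roots_of_unity e" "e > 0"
  shows "(*) z ` roots_of_unity (e * n) = roots_of_unity (e * n)"
proof -
  have z: "z ^ (e * n) = 1" "z \<noteq> 0"
    using assms by (auto simp: roots_of_unity_def power_mult power_0_left)
  have "w \<in> (*) z ` roots_of_unity (e * n)" if "w ^ (e * n) = 1" for w
    using that z by (intro image_eqI[of _ _ "w / z"]) (auto simp: roots_of_unity_def power_divide)
  then show ?thesis
    using z by (auto simp: roots_of_unity_def power_mult_distrib)
qed

lemma one_part_in_NCP_ee:
  assumes "e > 0"
  shows "{roots_of_unity (e * n) \<union> {0}} \<in> NCP_ee e n"
proof -
  let ?y = "roots_of_unity (e * n)"
  \<comment> \<open>The trace of the single part on \<open>?y\<close> must be nonempty, or the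
    restriction would discard it.\<close>
  have "1 \<in> ?y"
    by (simp add: roots_of_unity_def)
  then have "restrict_partition ?y {?y \<union> {0}} = {?y}" and "{?y} \<in> NCP ?y"
    by (auto simp: restrict_partition_def intro!: singleton_in_NCP)
  then show ?thesis
    using assms
    by (auto simp: NCP_ee_def NCP_e1_def mult_partition_def mult_roots_of_unity
        intro!: singleton_in_NCP)
qed

lemma common_refinement_in_NCP_e1:
  assumes "\<P> \<subseteq> NCP_e1 e n" "\<P> \<noteq> {}" "e > 0"
  shows "common_refinement \<P> \<in> NCP_e1 e n"
proof -
  have "mult_partition z (common_refinement \<P>) = common_refinement \<P>"
    if "z \<in> roots_of_unity e" for z
    using assms that roots_of_unity_nonzero[of z e]
    by (intro mult_common_refinement) (auto simp: NCP_e1_def)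
  moreover have "common_refinement \<P> \<in> NCP (roots_of_unity (e * n))"
    using assms by (intro common_refinement_in_NCP) (auto simp: NCP_e1_def)
  ultimately show ?thesis
    by (simp add: NCP_e1_def)
qed

lemma NCP_ee_partition_on: "u \<in> NCP_ee e n \<Longrightarrow> partition_on (insert 0 (roots_of_unity (e * n))) u"
  by (simp add: NCP_ee_def NCP_partition_on)

lemma common_refinement_in_NCP_ee:
  assumes "\<P> \<subseteq> NCP_ee e n" "\<P> \<noteq> {}" "e > 0"
  shows "common_refinement \<P> \<in> NCP_ee e n"
proof -
  let ?y = "roots_of_unity (e * n)"
  \<comment> \<open>Symmetry is imposed only after forgetting 0, so it has to be checked on the
    restricted partitions.\<close>
  have "restrict_partition ?y (common_refinement \<P>)
      = common_refinement (restrict_partition ?y ` \<P>)"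
    using assms NCP_ee_partition_on
    by (intro restrict_common_refinement[where x = "?y \<union> {0}"]) auto
  also have "\<dots> \<in> NCP_e1 e n"
    using assms by (intro common_refinement_in_NCP_e1) (auto simp: NCP_ee_def)
  finally show ?thesis
    using common_refinement_in_NCP[of \<P> "?y \<union> {0}"] assms
    by (auto simp: NCP_ee_def)
qed

lemma partial_order_NCP_ee: "partial_order (NCP_ee_poset e n)"
  by unfold_locales
    (auto simp: NCP_ee_poset_def NCP_ee_partition_on refines_refl
      dest: refines_asym intro: refines_trans)

theorem lemma1p17:
  fixes e n :: nat
  assumes "e > 0" and "n > 0"
  shows "lattice (NCP_ee_poset e n)"
proof -
  let ?L = "NCP_ee_poset e n" and ?x = "insert 0 (roots_of_unity (e * n))"
  interpret partial_order ?L
    by (rule partial_order_NCP_ee)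
  have "greatest ?L {?x} (carrier ?L)"
    using one_part_in_NCP_ee[OF assms(1)] NCP_ee_partition_on
    by (fastforce simp: greatest_def NCP_ee_poset_def refines_def dest: partition_onD1)
  moreover have "greatest ?L (common_refinement \<P>) (Lower ?L \<P>)"
    if \<P>: "\<P> \<subseteq> carrier ?L" "\<P> \<noteq> {}" for \<P>
  proof (rule greatest_LowerI)
    have sub: "\<P> \<subseteq> NCP_ee e n"
      using \<P> by (simp add: NCP_ee_poset_def)
    then have part: "partition_on ?x P" if "P \<in> \<P>" for P
      using that NCP_ee_partition_on by blast
    show "common_refinement \<P> \<in> carrier ?L"
      using common_refinement_in_NCP_ee[OF sub \<P>(2) assms(1)] by (simp add: NCP_ee_poset_def)
    show "common_refinement \<P> \<sqsubseteq>\<^bsub>?L\<^esub> P" if "P \<in> \<P>" for P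
      using refines_common_refinement[OF part that] by (simp add: NCP_ee_poset_def)
    \<comment> \<open>Among all partitions of \<open>?x\<close> refining every member of the family,
      the common refinement is the coarsest.\<close>
    show "R \<sqsubseteq>\<^bsub>?L\<^esub> common_refinement \<P>" if "R \<in> Lower ?L \<P>" for R
    proof -
      have "R \<in> NCP_ee e n" "\<And>P. P \<in> \<P> \<Longrightarrow> refines ?x R P"
        using that sub by (auto simp: NCP_ee_poset_def Lower_def)
      then show ?thesis
        using common_refinement_coarsest[OF part _ _ \<P>(2), of R] NCP_ee_partition_on
        by (simp add: NCP_ee_poset_def)
    qed
  qed (fact \<P>)
  \<comment> \<open>The greatest element serves as the infimum of the empty family and ensures that
    every set has an upper bound, so that suprema exist as well.\<close>
  ultimately interpret complete_lattice ?L
    by (intro complete_lattice_criterion1) blast+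
  show ?thesis ..
qed

end
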